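(* Let $b>0$, $\alpha,\theta:\mathbb{N}\to\mathbb{N}$ and $M:\mathbb{N}\to(0,\infty)$. Define $$\theta^M(n):=\max_{i\le n}\theta(i),\qquad \beta_{b,\theta}(k):=\theta^M\big(\lceil b^2(k+1)/2\rceil\big)+1,$$ $$\Phi_{b,\theta,M}(k):=\lceil b^2(k+1)^2\rceil+\beta_{b,\theta}\big(\lceil 2(k+1)^2M(k)\rceil-1\big),$$ and, for $g:\mathbb{N}\to\mathbb{N}$ and $k,n,r\in\mathbb{N}$, $$\chi_g^M(n,r):=\max_{i\le n}\max\{i+g(i)-1,\;g(i)(r+1)\},$$ $$\tilde\chi_g^M(n,r):=\max\Big\{2k+1,\;\max_{i\le n}\max\{i+g(i)-1,\;g(i)(r+1)\}\Big\}$$ (the latter depends also on $k$; the superscript $M$ in $\theta^M$, $\chi_g^M$, $\tilde\chi_g^M$ only indicates that a maximum is taken and does not refer to the function $M$). Define recursively $$(\Psi_0)_{b,\theta,M}(0,k,g):=0,\qquad (\Psi_0)_{b,\theta,M}(n+1,k,g):=\Phi_{b,\theta,M}\Big(\chi_g^M\big((\Psi_0)_{b,\theta,M}(n,k,g),\,4k+3\big)\Big),$$ $$(\Omega_0)_{b,\theta,M}(0,k,g):=0,\qquad (\Omega_0)_{b,\theta,M}(n+1,k,g):=\Phi_{b,\theta,M}\Big(\tilde\chi_g^M\big((\Omega_0)_{b,\theta,M}(n,k,g),\,8k+8\big)\Big),$$ and set $$\Psi_{b,\theta,M,\alpha}(k,g):=(\Psi_0)_{b,\theta,M}(\alpha(4k+3),k,g),\qquad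 \Omega_{b,\theta,M,\alpha}(k,g):=(\Omega_0)_{b,\theta,M}(\alpha(8k+7),k,g).$$ Then for all totally bounded CAT(0) spaces $X$ with modulus of total boundedness $\alpha$; all convex, lower semicontinuous, proper functions $f:X\to(-\infty,+\infty]$ with $\mathrm{Argmin}(f)\neq\emptyset$; all $x\in X$ such that $d(x,p)\le b$ for some minimizer $p$ of $f$; and all sequences $(\gamma_n)$ in $(0,\infty)$ such that $\sum_{n=0}^\infty\gamma_n=\infty$ with rate of divergence $\theta$ and $M(k)\ge\max_{0\le i\le k}\gamma_i$ for all $k\in\mathbb{N}$, we have that: (i) $\Psi_{b,\theta,M,\alpha}$ is a rate of metastability for the proximal point algorithm $(x_n)$ starting with $x$, i.e. for all $k\in\mathbb{N}$ and all $g:\mathbb{N}\to\mathbb{N}$ there is an $N\le\Psi_{b,\theta,M,\alpha}(k,g)$ such that for all $i,j\in[N,N+g(N)]$, $$d(x_i,x_j)\le\frac1{k+1};$$ (ii) for all $k\in\mathbb{N}$ and all $g:\mathbb{N}\to\mathbb{N}$ there is an $N\le\Omega_{b,\theta,M,\alpha}(k,g)$ such that for all $i,j\in[N,N+g(N)]$, $$d(x_i,x_j)\le\frac1{k+1},$$ and for all $i\in[N,N+g(N)]$ and all $m\le k$ ($m\in\mathbb{N}$), $$d(x_i,J_{\gamma_m f}x_i)\le\frac1{k+1}.$$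
   Context: $\mathbb{N}=\{0,1,2,\ldots\}$ and $[m,n]=\{m,m+1,\ldots,n\}$ for $m\le n$ in $\mathbb{N}$. $d$ denotes the metric of $X$. $\mathrm{Argmin}(f)$ is the set of minimizers of $f$, i.e. points $x\in X$ with $f(x)=\inf_{y\in X}f(y)$. For $\gamma>0$, the resolvent $J_{\gamma f}:X\to X$ is defined by letting $J_{\gamma f}(x)$ be the (unique) minimizer over $y\in X$ of $\gamma f(y)+\frac12 d^2(x,y)$. It is understood throughout that this is well defined for all $x\in X$ and $\gamma>0$ (this is automatic when $X$ is complete). Given a sequence $(\gamma_n)_{n\in\mathbb{N}}$ in $(0,\infty)$, the proximal point algorithm starting with $x\in X$ is the sequence $x_0:=x$, $x_{n+1}:=J_{\gamma_n f}x_n$ for all $n\in\mathbb{N}$. A modulus of total boundedness for $X$ is a function $\alpha:\mathbb{N}\to\mathbb{N}$ such that for any $k\in\mathbb{N}$ and any sequence $(y_n)$ in $X$ there exist $i<j$ in $[0,\alpha(k)]$ with $d(y_i,y_j)\le\frac1{k+1}$. A rate of divergence of $\sum_{n=0}^\infty\gamma_n$ is a function $\theta:\mathbb{N}\to\mathbb{N}$ such that $\sum_{n=0}^{\theta(P)}\gamma_n\ge P$ for all $P\in\mathbb{N}$. *)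

theory Defs
  imports "HOL-Analysis.Analysis"
begin

text \<open>Geodesics are parametrised proportionally to arc length on the unit interval.\<close>

definition geodesic_from_to :: "(real \<Rightarrow> 'a::metric_space) \<Rightarrow> 'a \<Rightarrow> 'a \<Rightarrow> bool" where
  "geodesic_from_to c x y \<longleftrightarrow> c 0 = x \<and> c 1 = y \<and>
     (\<forall>s\<in>{0..1}. \<forall>t\<in>{0..1}. dist (c s) (c t) = \<bar>s - t\<bar> * dist x y)"

definition geodesic_space :: "'a::metric_space itself \<Rightarrow> bool" where
  "geodesic_space _ \<longleftrightarrow> (\<forall>x y :: 'a. \<exists>c. geodesic_from_to c x y)"

definition comparison_triangle ::
    "'a::metric_space \<Rightarrow> 'a \<Rightarrow> 'a \<Rightarrow> real ^ 2 \<Rightarrow> real ^ 2 \<Rightarrow> real ^ 2 \<Rightarrow> bool" where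
  "comparison_triangle p q r p' q' r' \<longleftrightarrow>
     dist p' q' = dist p q \<and> dist q' r' = dist q r \<and> dist r' p' = dist r p"

text \<open>The comparison inequality is only stated for points on the two sides issuing from \<open>p\<close>:
  any two sides of a triangle share a vertex, the vertices are arbitrary, and two points of the
  same side are always at the same distance as their comparison points. A comparison triangle
  always exists and is unique up to isometry, so quantifying over all of them is harmless.\<close>

definition CAT0_space :: "'a::metric_space itself \<Rightarrow> bool" where
  "CAT0_space _ \<longleftrightarrow> geodesic_space TYPE('a) \<and>
     (\<forall>(p::'a) q r c1 c2 p' q' r'.
        geodesic_from_to c1 p q \<longrightarrow> geodesic_from_to c2 p r \<longrightarrow>
        comparison_triangle p q r p' q' r' \<longrightarrow>
        (\<forall>x\<in>c1 ` {0..1}. \<forall>y\<in>c2 ` {0..1}.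
          \<forall>x'\<in>closed_segment p' q'. \<forall>y'\<in>closed_segment p' r'.
            dist p' x' = dist p x \<longrightarrow> dist p' y' = dist p y \<longrightarrow> dist x y \<le> dist x' y'))"

text \<open>By contradiction, the existence of a modulus implies total boundedness.\<close>

definition modulus_of_total_boundedness ::
    "'a::metric_space itself \<Rightarrow> (nat \<Rightarrow> nat) \<Rightarrow> bool" where
  "modulus_of_total_boundedness _ \<alpha> \<longleftrightarrow>
     (\<forall>k. \<forall>y :: nat \<Rightarrow> 'a. \<exists>i j. i < j \<and> j \<le> \<alpha> k \<and> dist (y i) (y j) \<le> 1 / (real k + 1))"

text \<open>In \<^typ>\<open>ereal\<close> the product of \<open>0\<close> and \<open>\<infinity>\<close> is \<open>0\<close>, so at \<open>t = 0\<close> and \<open>t = 1\<close> the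
  convexity inequality is trivially true.\<close>

definition geodesically_convex :: "('a::metric_space \<Rightarrow> ereal) \<Rightarrow> bool" where
  "geodesically_convex f \<longleftrightarrow> (\<forall>x y c. geodesic_from_to c x y \<longrightarrow>
     (\<forall>t\<in>{0..1}. f (c t) \<le> ereal (1 - t) * f x + ereal t * f y))"

definition lower_semicontinuous :: "('a::topological_space \<Rightarrow> ereal) \<Rightarrow> bool" where
  "lower_semicontinuous f \<longleftrightarrow> (\<forall>x. f x \<le> Liminf (at x) f)"

definition proper_fun :: "('a \<Rightarrow> ereal) \<Rightarrow> bool" where
  "proper_fun f \<longleftrightarrow> (\<forall>x. f x \<noteq> -\<infinity>) \<and> (\<exists>x. f x \<noteq> \<infinity>)"

definition Argmin :: "('a \<Rightarrow> ereal) \<Rightarrow> 'a set" where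
  "Argmin f = {x. f x = (INF y. f y)}"

definition prox_objective :: "real \<Rightarrow> ('a::metric_space \<Rightarrow> ereal) \<Rightarrow> 'a \<Rightarrow> 'a \<Rightarrow> ereal" where
  "prox_objective \<gamma> f x y = ereal \<gamma> * f y + ereal (1/2 * (dist x y)\<^sup>2)"

definition resolvent :: "real \<Rightarrow> ('a::metric_space \<Rightarrow> ereal) \<Rightarrow> 'a \<Rightarrow> 'a" where
  "resolvent \<gamma> f x = (THE y. y \<in> Argmin (prox_objective \<gamma> f x))"

definition resolvents_well_defined :: "('a::metric_space \<Rightarrow> ereal) \<Rightarrow> bool" where
  "resolvents_well_defined f \<longleftrightarrow>
     (\<forall>\<gamma>>0. \<forall>x. \<exists>!y. y \<in> Argmin (prox_objective \<gamma> f x))"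

primrec proximal_point ::
    "('a::metric_space \<Rightarrow> ereal) \<Rightarrow> (nat \<Rightarrow> real) \<Rightarrow> 'a \<Rightarrow> nat \<Rightarrow> 'a" where
  "proximal_point f \<gamma> x 0 = x"
| "proximal_point f \<gamma> x (Suc n) = resolvent (\<gamma> n) f (proximal_point f \<gamma> x n)"

definition rate_of_divergence :: "(nat \<Rightarrow> real) \<Rightarrow> (nat \<Rightarrow> nat) \<Rightarrow> bool" where
  "rate_of_divergence \<gamma> \<theta> \<longleftrightarrow> (\<forall>P. (\<Sum>n\<le>\<theta> P. \<gamma> n) \<ge> real P)"

definition rate_of_metastability ::
    "(nat \<Rightarrow> 'a::metric_space) \<Rightarrow> (nat \<Rightarrow> (nat \<Rightarrow> nat) \<Rightarrow> nat) \<Rightarrow> bool" where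
  "rate_of_metastability u \<Psi> \<longleftrightarrow>
     (\<forall>k g. \<exists>N\<le>\<Psi> k g. \<forall>i\<in>{N..N + g N}. \<forall>j\<in>{N..N + g N}.
        dist (u i) (u j) \<le> 1 / (real k + 1))"

definition max_upto :: "(nat \<Rightarrow> nat) \<Rightarrow> nat \<Rightarrow> nat" where
  "max_upto h n = Max (h ` {..n})"

definition beta_rate :: "real \<Rightarrow> (nat \<Rightarrow> nat) \<Rightarrow> nat \<Rightarrow> nat" where
  "beta_rate b \<theta> k = max_upto \<theta> (nat \<lceil>b\<^sup>2 * (real k + 1) / 2\<rceil>) + 1"

definition Phi :: "real \<Rightarrow> (nat \<Rightarrow> nat) \<Rightarrow> (nat \<Rightarrow> real) \<Rightarrow> nat \<Rightarrow> nat" where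
  "Phi b \<theta> M k = nat \<lceil>b\<^sup>2 * (real k + 1)\<^sup>2\<rceil> +
     beta_rate b \<theta> (nat (\<lceil>2 * (real k + 1)\<^sup>2 * M k\<rceil> - 1))"

text \<open>Truncated subtraction in \<open>i + g i - 1\<close> only matters for \<open>i = g i = 0\<close>, where the
  maximum with \<open>g i * (r + 1)\<close> is \<open>0\<close> in any case.\<close>

definition chi :: "(nat \<Rightarrow> nat) \<Rightarrow> nat \<Rightarrow> nat \<Rightarrow> nat" where
  "chi g n r = max_upto (\<lambda>i. max (i + g i - 1) (g i * (r + 1))) n"

definition chi_tilde :: "nat \<Rightarrow> (nat \<Rightarrow> nat) \<Rightarrow> nat \<Rightarrow> nat \<Rightarrow> nat" where
  "chi_tilde k g n r =
     max (2 * k + 1) (max_upto (\<lambda>i. max (i + g i - 1) (g i * (r + 1))) n)"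

primrec Psi0 ::
    "real \<Rightarrow> (nat \<Rightarrow> nat) \<Rightarrow> (nat \<Rightarrow> real) \<Rightarrow> nat \<Rightarrow> nat \<Rightarrow> (nat \<Rightarrow> nat) \<Rightarrow> nat" where
  "Psi0 b \<theta> M 0 k g = 0"
| "Psi0 b \<theta> M (Suc n) k g = Phi b \<theta> M (chi g (Psi0 b \<theta> M n k g) (4 * k + 3))"

primrec Omega0 ::
    "real \<Rightarrow> (nat \<Rightarrow> nat) \<Rightarrow> (nat \<Rightarrow> real) \<Rightarrow> nat \<Rightarrow> nat \<Rightarrow> (nat \<Rightarrow> nat) \<Rightarrow> nat" where
  "Omega0 b \<theta> M 0 k g = 0"
| "Omega0 b \<theta> M (Suc n) k g = Phi b \<theta> M (chi_tilde k g (Omega0 b \<theta> M n k g) (8 * k + 8))"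

definition Psi ::
    "real \<Rightarrow> (nat \<Rightarrow> nat) \<Rightarrow> (nat \<Rightarrow> real) \<Rightarrow> (nat \<Rightarrow> nat) \<Rightarrow> nat \<Rightarrow> (nat \<Rightarrow> nat) \<Rightarrow> nat" where
  "Psi b \<theta> M \<alpha> k g = Psi0 b \<theta> M (\<alpha> (4 * k + 3)) k g"

definition Omega ::
    "real \<Rightarrow> (nat \<Rightarrow> nat) \<Rightarrow> (nat \<Rightarrow> real) \<Rightarrow> (nat \<Rightarrow> nat) \<Rightarrow> nat \<Rightarrow> (nat \<Rightarrow> nat) \<Rightarrow> nat" where
  "Omega b \<theta> M \<alpha> k g = Omega0 b \<theta> M (\<alpha> (8 * k + 7)) k g"

end

theory Submission
  imports Defs
begin

text \<open>The resolvent inequality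
  \<open>2 \<gamma> (f (J x) - f p) \<le> d\<^sup>2(x, p) - d\<^sup>2(J x, p) - d\<^sup>2(x, J x)\<close> follows by comparing \<open>J x\<close> with
  points of the geodesic from \<open>J x\<close> to \<open>p\<close> and letting them tend to \<open>J x\<close>. Combined with the
  quadrilateral inequality it makes \<open>J\<close> nonexpansive; summed along the algorithm it gives a rate for
  \<open>f (x\<^sub>n) \<rightarrow> min f\<close>, and hence a bound on the first index whose iterate is moved by at most
  \<open>1 / (k + 1)\<close> by the first \<open>k + 1\<close> resolvents. Nonexpansivity makes the iterates almost Fejer
  monotone with respect to such approximate fixed points, and among sufficiently many
  approximate fixed points along the algorithm the modulus of total boundedness finds two that are
  close.\<close>

section \<open>Comparison inequalities\<close>

text \<open>\<open>CAT0_space\<close> speaks of all comparison triangles, so applying it requires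
  one. Put \<open>p'\<close> at the origin and \<open>q'\<close> on the first axis; the law of
  cosines dictates the first coordinate \<open>u\<close> of \<open>r'\<close>. The triangle
  inequalities give \<open>\<bar>u\<bar> \<le> c\<close>, so the second coordinate \<open>v\<close>
  is real.\<close>

lemma comparison_triangle_exists:
  fixes p q r :: "'a::metric_space"
  assumes "p \<noteq> q"
  obtains p' q' r' where "comparison_triangle p q r p' q' r'"
proof -
  define a where "a = dist p q"
  define c where "c = dist r p"
  define e where "e = dist q r"
  define u where "u = (a\<^sup>2 + c\<^sup>2 - e\<^sup>2) / (2 * a)"
  have a: "a > 0" and c: "c \<ge> 0" and e: "e \<ge> 0"
    using assms by (auto simp: a_def c_def e_def)
  have tri: "a \<le> c + e" "c \<le> a + e" "e \<le> a + c"
    unfolding a_def c_def e_def by metric+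
  have "(a - c)\<^sup>2 \<le> e\<^sup>2"
    using tri e by (simp add: abs_le_square_iff[symmetric])
  moreover have "e\<^sup>2 \<le> (a + c)\<^sup>2"
    using tri e by (simp add: power_mono)
  ultimately have "\<bar>a\<^sup>2 + c\<^sup>2 - e\<^sup>2\<bar> \<le> c * (2 * a)"
    by (simp add: power2_eq_square algebra_simps abs_le_iff)
  then have "\<bar>u\<bar> \<le> c"
    using a by (simp add: u_def abs_mult pos_divide_le_eq)
  then have u: "u\<^sup>2 \<le> c\<^sup>2"
    using c by (simp add: abs_le_square_iff[symmetric])
  define v where "v = sqrt (c\<^sup>2 - u\<^sup>2)"
  have v: "v\<^sup>2 = c\<^sup>2 - u\<^sup>2"
    using u by (simp add: v_def)
  have ua: "2 * a * u = a\<^sup>2 + c\<^sup>2 - e\<^sup>2"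
    using a by (simp add: u_def)
  have "(a - u)\<^sup>2 + v\<^sup>2 = e\<^sup>2"
    using v ua by (simp add: power2_eq_square algebra_simps)
  then have "comparison_triangle p q r (0 :: real^2) (vector [a, 0]) (vector [u, v])"
    using a c e v
    by (simp add: comparison_triangle_def a_def[symmetric] c_def[symmetric] e_def[symmetric]
        dist_vec_def L2_set_def sum_2 dist_real_def)
  then show ?thesis
    by (rule that)
qed

lemma CAT0_geodesicE:
  fixes x y :: "'a::metric_space"
  assumes "CAT0_space TYPE('a)"
  obtains c where "geodesic_from_to c x y"
  using assms unfolding CAT0_space_def geodesic_space_def by meson

text \<open>In the plane this is an identity (Stewart's theorem); comparison turns it into an
  inequality. For \<open>t = 1/2\<close> it is the Bruhat-Tits (CN) inequality.\<close>

lemma CAT0_geodesic_dist_sq_le: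
  fixes x y z :: "'a::metric_space"
  assumes "CAT0_space TYPE('a)" and c: "geodesic_from_to c x y" and t: "t \<in> {0..1}"
  shows "(dist z (c t))\<^sup>2 \<le> (1 - t) * (dist z x)\<^sup>2 + t * (dist z y)\<^sup>2 - t * (1 - t) * (dist x y)\<^sup>2"
proof (cases "x = y")
  case True
  have "dist (c 0) (c t) = \<bar>0 - t\<bar> * dist x y"
    using c t unfolding geodesic_from_to_def by (meson atLeastAtMost_iff order_refl zero_le_one)
  with True c have "c t = x"
    by (simp add: geodesic_from_to_def)
  then show ?thesis
    using True by (simp add: algebra_simps)
next
  case False
  obtain p' q' r' where tri: "comparison_triangle x y z p' q' r'"
    using comparison_triangle_exists[OF False] .
  obtain c2 where c2: "geodesic_from_to c2 x z"
    using CAT0_geodesicE[OF assms(1)] .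
  have c2_1: "c2 1 = z" and c0: "c 0 = x"
    using c c2 by (auto simp: geodesic_from_to_def)
  define w where "w = (1 - t) *\<^sub>R p' + t *\<^sub>R q'"
  have d: "dist p' q' = dist x y" "dist q' r' = dist y z" "dist r' p' = dist z x"
    using tri by (auto simp: comparison_triangle_def)
  have "dist (c 0) (c t) = \<bar>0 - t\<bar> * dist x y"
    using c t unfolding geodesic_from_to_def by (meson atLeastAtMost_iff order_refl zero_le_one)
  then have dxc: "dist x (c t) = t * dist x y"
    using t c0 by simp
  have "p' - w = t *\<^sub>R (p' - q')"
    by (simp add: w_def algebra_simps)
  then have pw: "dist p' w = dist x (c t)"
    using t d(1) dxc by (simp add: dist_norm)
  have seg: "w \<in> closed_segment p' q'"
    using t by (auto simp: closed_segment_def w_def)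
  have "dist (c t) z \<le> dist w r'"
  proof -
    \<comment> \<open>On the second side the comparison is made at the vertex \<open>z\<close>
      itself, whose comparison point is \<open>r'\<close>.\<close>
    have "c t \<in> c ` {0..1}" "z \<in> c2 ` {0..1}" "r' \<in> closed_segment p' r'"
      using t c2_1 by (auto intro: image_eqI[of _ _ 1])
    moreover have "dist p' r' = dist x z"
      using d(3) by (simp add: dist_commute)
    ultimately show ?thesis
      using assms(1) c c2 tri seg pw unfolding CAT0_space_def by blast
  qed
  then have "(dist z (c t))\<^sup>2 \<le> (dist w r')\<^sup>2"
    by (simp add: dist_commute power_mono)
  also have "(dist w r')\<^sup>2 =
      (1 - t) * (dist r' p')\<^sup>2 + t * (dist q' r')\<^sup>2 - t * (1 - t) * (dist p' q')\<^sup>2"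
    unfolding w_def dist_norm power2_norm_eq_inner
    by (simp add: inner_diff_left inner_diff_right inner_add_left inner_add_right
        inner_commute algebra_simps)
  finally show ?thesis
    by (simp only: d dist_commute[of z y])
qed

text \<open>The diagonals are \<open>x v\<close> and \<open>y u\<close>. Bound the distances of
  \<open>y\<close> and \<open>u\<close> to the midpoint \<open>m\<close> of \<open>x v\<close> and
  join them through \<open>m\<close>.\<close>

lemma CAT0_quadrilateral:
  fixes x y u v :: "'a::metric_space"
  assumes "CAT0_space TYPE('a)"
  shows "(dist x v)\<^sup>2 + (dist y u)\<^sup>2 \<le>
    (dist x y)\<^sup>2 + (dist y v)\<^sup>2 + (dist v u)\<^sup>2 + (dist u x)\<^sup>2"
proof -
  obtain c where c: "geodesic_from_to c x v"
    using CAT0_geodesicE[OF assms] .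
  define m where "m = c (1/2)"
  have y: "(dist y m)\<^sup>2 \<le> (dist y x)\<^sup>2 / 2 + (dist y v)\<^sup>2 / 2 - (dist x v)\<^sup>2 / 4"
    using CAT0_geodesic_dist_sq_le[OF assms c, of "1/2" y] by (simp add: m_def)
  have u: "(dist u m)\<^sup>2 \<le> (dist u x)\<^sup>2 / 2 + (dist u v)\<^sup>2 / 2 - (dist x v)\<^sup>2 / 4"
    using CAT0_geodesic_dist_sq_le[OF assms c, of "1/2" u] by (simp add: m_def)
  have "(dist y u)\<^sup>2 \<le> (dist y m + dist u m)\<^sup>2"
    by (intro power_mono dist_triangle2) auto
  also have "\<dots> \<le> 2 * (dist y m)\<^sup>2 + 2 * (dist u m)\<^sup>2"
    using sum_squares_bound[of "dist y m" "dist u m"] by (simp add: power2_sum)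
  finally show ?thesis
    using y u by (simp add: dist_commute)
qed

section \<open>Resolvents\<close>

lemma Argmin_le: "p \<in> Argmin f \<Longrightarrow> f p \<le> f y"
  by (simp add: Argmin_def INF_lower)

locale CAT0_resolvents =
  fixes f :: "'a::metric_space \<Rightarrow> ereal"
  assumes CAT0: "CAT0_space TYPE('a)"
    and convex: "geodesically_convex f"
    and proper: "proper_fun f"
    and resolvents: "resolvents_well_defined f"
begin

lemma resolvent_minimal:
  assumes "\<gamma> > 0"
  shows "prox_objective \<gamma> f x (resolvent \<gamma> f x) \<le> prox_objective \<gamma> f x y"
proof -
  have "\<exists>!y. y \<in> Argmin (prox_objective \<gamma> f x)"
    using resolvents assms by (auto simp: resolvents_well_defined_def)
  then have "resolvent \<gamma> f x \<in> Argmin (prox_objective \<gamma> f x)"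
    unfolding resolvent_def by (rule theI')
  then show ?thesis
    by (rule Argmin_le)
qed

text \<open>Compare with a point of the domain of \<open>f\<close>. The start \<open>x\<close> may
  have an infinite value.\<close>

lemma f_resolvent_finite:
  assumes "\<gamma> > 0"
  shows "\<bar>f (resolvent \<gamma> f x)\<bar> \<noteq> \<infinity>"
proof -
  obtain y where y: "f y \<noteq> \<infinity>"
    using proper by (auto simp: proper_fun_def)
  have "f y \<noteq> -\<infinity>" "f (resolvent \<gamma> f x) \<noteq> -\<infinity>"
    using proper by (auto simp: proper_fun_def)
  with y resolvent_minimal[OF assms, of x y] assms show ?thesis
    by (cases "f y"; cases "f (resolvent \<gamma> f x)") (auto simp: prox_objective_def)
qed

text \<open>Here \<open>p\<close> is any point of the domain, not only a minimizer; nonexpansivity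
  takes another resolvent value for it.\<close>

lemma resolvent_inequality:
  assumes "\<gamma> > 0" and p: "\<bar>f p\<bar> \<noteq> \<infinity>"
  shows "2 * \<gamma> * (real_of_ereal (f (resolvent \<gamma> f x)) - real_of_ereal (f p)) \<le>
    (dist x p)\<^sup>2 - (dist (resolvent \<gamma> f x) p)\<^sup>2 - (dist x (resolvent \<gamma> f x))\<^sup>2"
proof -
  define J where "J = resolvent \<gamma> f x"
  obtain fJ where fJ: "f J = ereal fJ"
    using f_resolvent_finite[OF assms(1), of x] by (auto simp: J_def)
  obtain fp where fp: "f p = ereal fp"
    using p by auto
  obtain c where c: "geodesic_from_to c J p"
    using CAT0_geodesicE[OF CAT0] .
  define A where "A = 2 * \<gamma> * (fJ - fp)"
  define B where "B = (dist x p)\<^sup>2 - (dist J p)\<^sup>2 - (dist x J)\<^sup>2"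
  define D where "D = (dist J p)\<^sup>2"
  have ineq: "A \<le> B + t * D" if t: "0 < t" "t < 1" for t
  proof -
    have "f (c t) \<le> ereal (1 - t) * f J + ereal t * f p"
      using convex c t unfolding geodesically_convex_def by (meson atLeastAtMost_iff less_imp_le)
    then have le: "f (c t) \<le> ereal ((1 - t) * fJ + t * fp)"
      by (simp add: fJ fp)
    moreover have "f (c t) \<noteq> -\<infinity>"
      using proper by (auto simp: proper_fun_def)
    ultimately obtain fc where fc: "f (c t) = ereal fc"
      by (cases "f (c t)") auto
    have "\<gamma> * fJ + (dist x J)\<^sup>2 / 2 \<le> \<gamma> * fc + (dist x (c t))\<^sup>2 / 2"
      using resolvent_minimal[OF assms(1), of x "c t"]
      by (simp add: J_def[symmetric] prox_objective_def fJ fc)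
    \<comment> \<open>Convexity of \<open>f\<close> bounds the first summand, strong convexity of
      the squared distance the second. What then remains is divisible by \<open>t\<close>.\<close>
    also have "\<dots> \<le> \<gamma> * ((1 - t) * fJ + t * fp) +
        ((1 - t) * (dist x J)\<^sup>2 + t * (dist x p)\<^sup>2 - t * (1 - t) * (dist J p)\<^sup>2) / 2"
      using CAT0_geodesic_dist_sq_le[OF CAT0 c, of t x] t le assms(1)
      by (intro add_mono mult_left_mono divide_right_mono) (auto simp: fc)
    finally have "t * A \<le> t * (B + t * D)"
      by (simp add: A_def B_def D_def field_simps)
    then show ?thesis
      using t by simp
  qed
  have "((\<lambda>t. B + t * D) \<longlongrightarrow> B + 0 * D) (at_right 0)"
    by (intro tendsto_intros)
  moreover have "eventually (\<lambda>t. A \<le> B + t * D) (at_right 0)"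
    unfolding eventually_at_right_field using ineq by (intro exI[of _ 1]) auto
  ultimately have "A \<le> B + 0 * D"
    by (intro tendsto_lowerbound[where F = "at_right 0"]) auto
  then show ?thesis
    by (simp add: A_def B_def J_def[symmetric] fJ fp)
qed

text \<open>Test the resolvent inequality for \<open>x\<close> at \<open>?v\<close> and for
  \<open>y\<close> at \<open>?u\<close> and add: the values of \<open>f\<close> cancel. The
  quadrilateral inequality with diagonals \<open>x ?v\<close> and \<open>y ?u\<close> absorbs the
  mixed distances.\<close>

lemma resolvent_nonexpansive:
  assumes "\<gamma> > 0"
  shows "dist (resolvent \<gamma> f x) (resolvent \<gamma> f y) \<le> dist x y"
proof -
  let ?u = "resolvent \<gamma> f x" and ?v = "resolvent \<gamma> f y"
  have "2 * (dist ?u ?v)\<^sup>2 \<le> (dist x ?v)\<^sup>2 + (dist y ?u)\<^sup>2 - (dist x ?u)\<^sup>2 - (dist y ?v)\<^sup>2"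
    using resolvent_inequality[OF assms f_resolvent_finite[OF assms], of x y]
      resolvent_inequality[OF assms f_resolvent_finite[OF assms], of y x]
    by (simp add: dist_commute algebra_simps)
  then have "(dist ?u ?v)\<^sup>2 \<le> (dist x y)\<^sup>2"
    using CAT0_quadrilateral[OF CAT0, of x ?v y ?u]
    unfolding dist_commute[of ?v ?u] dist_commute[of ?u x] by linarith
  then show ?thesis
    by (rule power2_le_imp_le[OF _ zero_le_dist])
qed

lemma f_resolvent_le:
  assumes "\<gamma> > 0"
  shows "f (resolvent \<gamma> f x) \<le> f x"
proof -
  obtain fJ where "f (resolvent \<gamma> f x) = ereal fJ"
    using f_resolvent_finite[OF assms, of x] by auto
  moreover have "f x \<noteq> -\<infinity>"
    using proper by (auto simp: proper_fun_def)
  ultimately show ?thesis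
  proof (cases "f x")
    case (real r)
    with resolvent_minimal[OF assms, of x x] \<open>f (resolvent \<gamma> f x) = ereal fJ\<close>
    have "\<gamma> * fJ + (dist x (resolvent \<gamma> f x))\<^sup>2 / 2 \<le> \<gamma> * r"
      by (simp add: prox_objective_def)
    then have "\<gamma> * fJ \<le> \<gamma> * r"
      by (rule order_trans[rotated]) simp
    with assms real \<open>f (resolvent \<gamma> f x) = ereal fJ\<close> show ?thesis
      by simp
  qed auto
qed

text \<open>Compare the resolvent with \<open>x\<close> itself and bound its value below by
  \<open>f p\<close>. This turns a small gap to the minimum into a small displacement.\<close>

lemma dist_resolvent_sq_le:
  assumes "\<gamma> > 0" and p: "p \<in> Argmin f" and x: "\<bar>f x\<bar> \<noteq> \<infinity>"
  shows "(dist x (resolvent \<gamma> f x))\<^sup>2 \<le> 2 * \<gamma> * (real_of_ereal (f x) - real_of_ereal (f p))"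
proof -
  obtain fJ where fJ: "f (resolvent \<gamma> f x) = ereal fJ"
    using f_resolvent_finite[OF assms(1), of x] by auto
  obtain fx where fx: "f x = ereal fx"
    using x by auto
  have "f p \<le> f x" "f p \<noteq> -\<infinity>"
    using p proper Argmin_le by (auto simp: proper_fun_def)
  then obtain fp where fp: "f p = ereal fp"
    using fx by (cases "f p") auto
  have "\<gamma> * fp \<le> \<gamma> * fJ"
    using Argmin_le[OF p, of "resolvent \<gamma> f x"] fp fJ assms(1) by simp
  moreover have "\<gamma> * fJ + (dist x (resolvent \<gamma> f x))\<^sup>2 / 2 \<le> \<gamma> * fx"
    using resolvent_minimal[OF assms(1), of x x] by (simp add: prox_objective_def fJ fx)
  ultimately show ?thesis
    by (simp add: fx fp algebra_simps)
qed

end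

section \<open>The proximal point algorithm\<close>

lemma max_upto_ge: "i \<le> n \<Longrightarrow> h i \<le> max_upto h n"
  by (simp add: max_upto_def)

lemma mono_max_upto: "mono (max_upto h)"
  by (auto intro!: monoI Max_mono image_mono simp: max_upto_def)

text \<open>One index governs both the number of resolvents and the tolerance, so the sets shrink as
  it grows.\<close>

definition common_approx_fixpoints ::
    "('a::metric_space \<Rightarrow> ereal) \<Rightarrow> (nat \<Rightarrow> real) \<Rightarrow> nat \<Rightarrow> 'a set" where
  "common_approx_fixpoints f \<gamma> k = {z. \<forall>i\<le>k. dist z (resolvent (\<gamma> i) f z) \<le> 1 / (real k + 1)}"

lemma antimono_common_approx_fixpoints: "antimono (common_approx_fixpoints f \<gamma>)"
proof (rule antimonoI)
  fix k l :: nat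
  assume "k \<le> l"
  then have "1 / (real l + 1) \<le> 1 / (real k + 1)"
    by (simp add: frac_le)
  with \<open>k \<le> l\<close> show "common_approx_fixpoints f \<gamma> l \<subseteq> common_approx_fixpoints f \<gamma> k"
    unfolding common_approx_fixpoints_def by (auto intro: order_trans)
qed

locale CAT0_proximal_point = CAT0_resolvents f for f :: "'a::metric_space \<Rightarrow> ereal" +
  fixes \<gamma> :: "nat \<Rightarrow> real" and x :: 'a
  assumes gamma_pos: "\<And>n. \<gamma> n > 0"
begin

abbreviation xs :: "nat \<Rightarrow> 'a" where
  "xs \<equiv> proximal_point f \<gamma> x"

text \<open>\<open>xs 0\<close> need not lie in the domain of \<open>f\<close>, hence the successor.\<close>

lemma f_xs_finite: "\<bar>f (xs (Suc n))\<bar> \<noteq> \<infinity>"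
  using f_resolvent_finite[OF gamma_pos] by simp

lemma f_xs_antimono: "m \<le> n \<Longrightarrow> f (xs n) \<le> f (xs m)"
  by (rule lift_Suc_antimono_le[of "\<lambda>n. f (xs n)"]) (auto intro: f_resolvent_le gamma_pos)

text \<open>The values of \<open>f\<close> decrease along the iterates, so the last gap may replace
  each earlier one in the resolvent inequalities, whose right-hand sides telescope.\<close>

lemma f_xs_gap_bound:
  assumes p: "p \<in> Argmin f"
  shows "2 * (\<Sum>i\<le>n. \<gamma> i) * (real_of_ereal (f (xs (Suc n))) - real_of_ereal (f p)) \<le> (dist x p)\<^sup>2"
proof -
  let ?g = "\<lambda>n. real_of_ereal (f (xs n)) - real_of_ereal (f p)"
  have "f p \<le> f (xs 1)" "f p \<noteq> -\<infinity>"
    using p proper Argmin_le by (auto simp: proper_fun_def)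
  then have fp: "\<bar>f p\<bar> \<noteq> \<infinity>"
    using f_xs_finite[of 0] by (cases "f p") auto
  have step: "2 * \<gamma> i * ?g (Suc n) \<le> (dist (xs i) p)\<^sup>2 - (dist (xs (Suc i)) p)\<^sup>2" if "i \<le> n" for i
  proof -
    have "f (xs (Suc n)) \<le> f (xs (Suc i))"
      using that by (intro f_xs_antimono) simp
    then have "?g (Suc n) \<le> ?g (Suc i)"
      using f_xs_finite[of n] f_xs_finite[of i] by (intro diff_right_mono) (cases "f (xs (Suc n))"; cases "f (xs (Suc i))"; auto)
    then have "2 * \<gamma> i * ?g (Suc n) \<le> 2 * \<gamma> i * ?g (Suc i)"
      using gamma_pos[of i] by (intro mult_left_mono) auto
    also have "\<dots> \<le> (dist (xs i) p)\<^sup>2 - (dist (xs (Suc i)) p)\<^sup>2 - (dist (xs i) (xs (Suc i)))\<^sup>2"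
      using resolvent_inequality[OF gamma_pos fp, of i "xs i"] by simp
    also have "\<dots> \<le> (dist (xs i) p)\<^sup>2 - (dist (xs (Suc i)) p)\<^sup>2"
      by simp
    finally show ?thesis .
  qed
  have "2 * (\<Sum>i\<le>n. \<gamma> i) * ?g (Suc n) = (\<Sum>i\<le>n. 2 * \<gamma> i * ?g (Suc n))"
    by (simp add: sum_distrib_left sum_distrib_right mult.assoc)
  also have "\<dots> \<le> (\<Sum>i\<le>n. (dist (xs i) p)\<^sup>2 - (dist (xs (Suc i)) p)\<^sup>2)"
    using step by (intro sum_mono) simp
  also have "\<dots> = (dist (xs 0) p)\<^sup>2 - (dist (xs (Suc n)) p)\<^sup>2"
    by (rule sum_telescope)
  also have "\<dots> \<le> (dist x p)\<^sup>2"
    by simp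
  finally show ?thesis .
qed

lemma f_xs_gap_beta_rate:
  assumes p: "p \<in> Argmin f" and b: "dist x p \<le> b" and \<theta>: "rate_of_divergence \<gamma> \<theta>"
  shows "real_of_ereal (f (xs (beta_rate b \<theta> k))) - real_of_ereal (f p) \<le> 1 / (real k + 1)"
proof -
  define P where "P = nat \<lceil>b\<^sup>2 * (real k + 1) / 2\<rceil>"
  define T where "T = max_upto \<theta> P"
  define h where "h = real_of_ereal (f (xs (Suc T))) - real_of_ereal (f p)"
  have "b\<^sup>2 * (real k + 1) / 2 \<le> real P"
    unfolding P_def by linarith
  also have "\<dots> \<le> (\<Sum>n\<le>\<theta> P. \<gamma> n)"
    using \<theta> by (simp add: rate_of_divergence_def)
  \<comment> \<open>Passing from \<open>\<theta> P\<close> to the maximum \<open>T\<close> only adds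
    positive terms.\<close>
  also have "\<dots> \<le> (\<Sum>n\<le>T. \<gamma> n)"
    using max_upto_ge[of P P \<theta>] gamma_pos by (intro sum_mono2) (auto simp: T_def less_imp_le)
  finally have S: "b\<^sup>2 * (real k + 1) \<le> 2 * (\<Sum>n\<le>T. \<gamma> n)"
    by simp
  have S0: "2 * (\<Sum>n\<le>T. \<gamma> n) > 0"
    using gamma_pos by (simp add: sum_pos)
  have "2 * (\<Sum>n\<le>T. \<gamma> n) * h \<le> (dist x p)\<^sup>2"
    using f_xs_gap_bound[OF p] by (simp add: h_def)
  also have "\<dots> \<le> b\<^sup>2"
    using b by (intro power_mono) auto
  also have "\<dots> \<le> 2 * (\<Sum>n\<le>T. \<gamma> n) * (1 / (real k + 1))"
    using S by (simp add: field_simps)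
  finally have "h \<le> 1 / (real k + 1)"
    using S0 by (simp only: mult_le_cancel_left_pos)
  then show ?thesis
    by (simp add: h_def T_def P_def beta_rate_def)
qed

text \<open>A gap of at most \<open>1 / (2 * (k + 1)^2 * M k)\<close> makes the squared displacement
  under each of the first \<open>k + 1\<close> resolvents at most \<open>1 / (k + 1)^2\<close>,
  since their parameters are bounded by \<open>M k\<close>.\<close>

lemma common_approx_fixpoint_bound:
  assumes p: "p \<in> Argmin f" and b: "dist x p \<le> b" and \<theta>: "rate_of_divergence \<gamma> \<theta>"
    and M_pos: "M k > 0" and M: "\<And>i. i \<le> k \<Longrightarrow> \<gamma> i \<le> M k"
  shows "\<exists>N\<le>Phi b \<theta> M k. xs N \<in> common_approx_fixpoints f \<gamma> k"
proof (intro exI conjI)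
  define K where "K = nat (\<lceil>2 * (real k + 1)\<^sup>2 * M k\<rceil> - 1)"
  define N where "N = beta_rate b \<theta> K"
  define h where "h = real_of_ereal (f (xs N)) - real_of_ereal (f p)"
  show "beta_rate b \<theta> (nat (\<lceil>2 * (real k + 1)\<^sup>2 * M k\<rceil> - 1)) \<le> Phi b \<theta> M k"
    by (simp add: Phi_def)
  have Q: "2 * (real k + 1)\<^sup>2 * M k > 0"
    using M_pos by simp
  have K: "2 * (real k + 1)\<^sup>2 * M k \<le> real K + 1"
    unfolding K_def by linarith
  have h: "h \<le> 1 / (real K + 1)"
    using f_xs_gap_beta_rate[OF p b \<theta>] by (simp add: h_def N_def)
  also have "\<dots> \<le> 1 / (2 * (real k + 1)\<^sup>2 * M k)"
    using K Q by (intro divide_left_mono) auto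
  finally have h: "h \<le> 1 / (2 * (real k + 1)\<^sup>2 * M k)" .
  \<comment> \<open>\<open>beta_rate\<close> is a successor, so this iterate is a resolvent
    value.\<close>
  have N: "\<bar>f (xs N)\<bar> \<noteq> \<infinity>"
    using f_xs_finite by (simp add: N_def beta_rate_def)
  have "dist (xs N) (resolvent (\<gamma> i) f (xs N)) \<le> 1 / (real k + 1)" if i: "i \<le> k" for i
  proof -
    have "(dist (xs N) (resolvent (\<gamma> i) f (xs N)))\<^sup>2 \<le> 2 * \<gamma> i * h"
      using dist_resolvent_sq_le[OF gamma_pos p N] by (simp add: h_def)
    also have "\<dots> \<le> 2 * \<gamma> i * (1 / (2 * (real k + 1)\<^sup>2 * M k))"
      using h gamma_pos[of i] by (intro mult_left_mono) auto
    also have "\<dots> \<le> 2 * M k * (1 / (2 * (real k + 1)\<^sup>2 * M k))"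
      using M[OF i] Q by (intro mult_right_mono) auto
    also have "\<dots> = (1 / (real k + 1))\<^sup>2"
      using M_pos by (simp add: power_divide)
    finally show ?thesis
      by (rule power2_le_imp_le) simp
  qed
  then show "xs (beta_rate b \<theta> (nat (\<lceil>2 * (real k + 1)\<^sup>2 * M k\<rceil> - 1))) \<in> common_approx_fixpoints f \<gamma> k"
    by (simp add: common_approx_fixpoints_def N_def K_def)
qed

text \<open>Each of the resolvents with index from \<open>n\<close> to \<open>n + m - 1\<close>
  moves \<open>p\<close> by at most \<open>1 / (K + 1)\<close>, so by nonexpansivity each step costs
  at most that much. The bound on \<open>m * (r + 1)\<close> keeps the total below
  \<open>1 / (r + 1)\<close>.\<close>

lemma xs_almost_Fejer:
  assumes p: "p \<in> common_approx_fixpoints f \<gamma> K"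
    and K: "n + m - 1 \<le> K" "m * (r + 1) \<le> K" and l: "l \<le> m"
  shows "dist (xs (n + l)) p \<le> dist (xs n) p + 1 / (real r + 1)"
proof -
  have "dist (xs (n + l)) p \<le> dist (xs n) p + real l / (real K + 1)"
    using l
  proof (induction l)
    case (Suc l)
    let ?J = "resolvent (\<gamma> (n + l)) f"
    have "n + l \<le> K"
      using Suc.prems K(1) by simp
    then have Jp: "dist (?J p) p \<le> 1 / (real K + 1)"
      using p by (simp add: common_approx_fixpoints_def dist_commute)
    have "dist (xs (n + Suc l)) p \<le> dist (?J (xs (n + l))) (?J p) + dist (?J p) p"
      by (simp add: dist_triangle)
    also have "\<dots> \<le> dist (xs (n + l)) p + 1 / (real K + 1)"
      by (intro add_mono Jp resolvent_nonexpansive gamma_pos)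
    also have "\<dots> \<le> dist (xs n) p + real l / (real K + 1) + 1 / (real K + 1)"
      using Suc by simp
    also have "\<dots> = dist (xs n) p + real (Suc l) / (real K + 1)"
      by (simp add: add_divide_distrib)
    finally show ?case .
  qed simp
  also have "real l / (real K + 1) \<le> 1 / (real r + 1)"
  proof -
    have "l * (r + 1) \<le> K + 1"
      using mult_le_mono1[OF l, of "r + 1"] K(2) by linarith
    then have "real (l * (r + 1)) \<le> real (K + 1)"
      by (rule of_nat_mono)
    then show ?thesis
      by (simp add: field_simps)
  qed
  finally show ?thesis
    by simp
qed

end

section \<open>Finding close approximate points by total boundedness\<close>

text \<open>\<open>\<Phi>\<close> need not be monotone (nor is \<open>M\<close>), so \<open>B\<close> need not be either. The least index of an
  iterate in \<open>A k\<close> is monotone in \<open>k\<close>, and iterating it instead of \<open>\<Phi>\<close> gives a monotone sequence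
  below \<open>B\<close>.\<close>

lemma close_approximate_points:
  fixes u :: "nat \<Rightarrow> 'a::metric_space" and A :: "nat \<Rightarrow> 'a set"
  assumes \<alpha>: "modulus_of_total_boundedness TYPE('a) \<alpha>"
    and A: "antimono A" and \<Phi>: "\<And>k. \<exists>N\<le>\<Phi> k. u N \<in> A k"
    and X: "mono X"
    and B: "B 0 = 0" "\<And>n. B (Suc n) = \<Phi> (X (B n))"
  shows "\<exists>N\<le>B (\<alpha> q). \<exists>p\<in>A (X N). dist (u N) p \<le> 1 / (real q + 1)"
proof -
  define \<phi> where "\<phi> k = (LEAST N. u N \<in> A k)" for k
  have \<phi>_in: "u (\<phi> k) \<in> A k" for k
    unfolding \<phi>_def using \<Phi> by (metis LeastI_ex)
  have \<phi>_le: "\<phi> k \<le> \<Phi> k" for k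
    unfolding \<phi>_def using \<Phi>[of k] by (metis Least_le order_trans)
  have "mono \<phi>"
  proof (rule monoI)
    fix k l :: nat
    assume "k \<le> l"
    then have "u (\<phi> l) \<in> A k"
      using \<phi>_in antimonoD[OF A] by blast
    then show "\<phi> k \<le> \<phi> l"
      unfolding \<phi>_def[of k] by (rule Least_le)
  qed
  define s where "s n = ((\<lambda>n. \<phi> (X n)) ^^ n) 0" for n
  have s: "s 0 = 0" "s (Suc n) = \<phi> (X (s n))" for n
    by (simp_all add: s_def)
  have "s n \<le> s (Suc n)" for n
    by (induction n) (simp_all add: s monoD[OF \<open>mono \<phi>\<close>] monoD[OF X])
  then have s_mono: "s m \<le> s n" if "m \<le> n" for m n
    using that by (rule lift_Suc_mono_le)
  have s_le: "s n \<le> B n" for n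
  proof (induction n)
    case (Suc n)
    have "\<phi> (X (s n)) \<le> \<phi> (X (B n))"
      by (intro monoD[OF \<open>mono \<phi>\<close>] monoD[OF X] Suc)
    also have "\<dots> \<le> B (Suc n)"
      by (simp add: B \<phi>_le)
    finally show ?case
      by (simp add: s)
  qed (simp add: s)
  \<comment> \<open>The modulus is applied to the subsequence of \<open>u\<close> along
    \<open>s\<close>.\<close>
  obtain i j where ij: "i < j" "j \<le> \<alpha> q" "dist (u (s i)) (u (s j)) \<le> 1 / (real q + 1)"
    using \<alpha>[unfolded modulus_of_total_boundedness_def, THEN spec[of _ q], THEN spec[of _ "\<lambda>n. u (s n)"]]
    by blast
  \<comment> \<open>As \<open>i < j\<close>, the index \<open>s j\<close> was chosen for the set
    \<open>A (X (s j'))\<close> with \<open>i \<le> j'\<close>, which is contained in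
    \<open>A (X (s i))\<close>. So \<open>u (s j)\<close> serves as \<open>p\<close> for
    \<open>N = s i\<close>.\<close>
  then obtain j' where j': "j = Suc j'" "i \<le> j'"
    by (cases j) auto
  have "u (s j) \<in> A (X (s j'))"
    by (simp add: j' s \<phi>_in)
  then have "u (s j) \<in> A (X (s i))"
    using antimonoD[OF A monoD[OF X s_mono[OF j'(2)]]] by blast
  moreover have "s i \<le> B (\<alpha> q)"
    using s_mono[of i "\<alpha> q"] s_le[of "\<alpha> q"] ij by simp
  ultimately show ?thesis
    using ij(3) by blast
qed

section \<open>Assembling the two rates\<close>

lemma mono_chi: "mono (\<lambda>n. chi g n r)"
  unfolding chi_def by (rule mono_max_upto)

text \<open>These are the two conditions on \<open>K\<close> in \<open>xs_almost_Fejer\<close> for a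
  stretch of length \<open>g n\<close>.\<close>

lemma chi_ge: "n + g n - 1 \<le> chi g n r" "g n * (r + 1) \<le> chi g n r"
  unfolding chi_def
  using max_upto_ge[of n n "\<lambda>i. max (i + g i - 1) (g i * (r + 1))"] by auto

lemma chi_tilde_eq: "chi_tilde k g n r = max (2 * k + 1) (chi g n r)"
  by (simp add: chi_tilde_def chi_def)

theorem theorem3p5:
  fixes b :: real
    and \<alpha> \<theta> :: "nat \<Rightarrow> nat"
    and M :: "nat \<Rightarrow> real"
    and f :: "'a::metric_space \<Rightarrow> ereal"
    and x :: 'a
    and \<gamma> :: "nat \<Rightarrow> real"
  assumes "b > 0"
    and "\<And>k. M k > 0"
    and "CAT0_space TYPE('a)"
    and "totally_bounded (UNIV :: 'a set)"
    and "modulus_of_total_boundedness TYPE('a) \<alpha>"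
    and "geodesically_convex f"
    and "lower_semicontinuous f"
    and "proper_fun f"
    and "Argmin f \<noteq> {}"
    and "resolvents_well_defined f"
    and "\<exists>p\<in>Argmin f. dist x p \<le> b"
    and "\<And>n. \<gamma> n > 0"
    and "(\<Sum>n. ereal (\<gamma> n)) = \<infinity>"
    and "rate_of_divergence \<gamma> \<theta>"
    and "\<And>k. M k \<ge> Max (\<gamma> ` {0..k})"
  shows "rate_of_metastability (proximal_point f \<gamma> x) (Psi b \<theta> M \<alpha>) \<and>
    (\<forall>k g. \<exists>N\<le>Omega b \<theta> M \<alpha> k g.
      (\<forall>i\<in>{N..N + g N}. \<forall>j\<in>{N..N + g N}.
        dist (proximal_point f \<gamma> x i) (proximal_point f \<gamma> x j) \<le> 1 / (real k + 1)) \<and>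
      (\<forall>i\<in>{N..N + g N}. \<forall>m\<le>k.
        dist (proximal_point f \<gamma> x i) (resolvent (\<gamma> m) f (proximal_point f \<gamma> x i))
          \<le> 1 / (real k + 1)))"
proof -
  interpret CAT0_proximal_point f \<gamma> x
    using assms by unfold_locales auto
  obtain p0 where p0: "p0 \<in> Argmin f" "dist x p0 \<le> b"
    using assms by blast
  have M: "\<gamma> i \<le> M k" if "i \<le> k" for i k
    using that by (intro order_trans[OF Max_ge assms(15)]) auto
  note Phi_bound = common_approx_fixpoint_bound[where M = M, OF p0 assms(14) assms(2) M]
  note close = close_approximate_points[where A = "common_approx_fixpoints f \<gamma>" and \<Phi> = "Phi b \<theta> M",
      OF assms(5) antimono_common_approx_fixpoints Phi_bound]
  \<comment> \<open>The first error is the distance from \<open>xs N\<close> to \<open>p\<close>,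
    the second the loss along the window of length \<open>g N\<close>.\<close>
  have near: "dist (xs i) p \<le> 1 / (real q + 1) + 1 / (real r + 1)"
    if "p \<in> common_approx_fixpoints f \<gamma> K" "chi g N r \<le> K" "dist (xs N) p \<le> 1 / (real q + 1)"
      "i \<in> {N..N + g N}" for p K g N q r i
  proof -
    have "dist (xs (N + (i - N))) p \<le> dist (xs N) p + 1 / (real r + 1)"
      using that chi_ge[where n = N and g = g and r = r] by (intro xs_almost_Fejer[where n = N and m = "g N", OF that(1)]) auto
    then show ?thesis
      using that by auto
  qed
  have "\<exists>N\<le>Psi b \<theta> M \<alpha> k g. \<forall>i\<in>{N..N + g N}. \<forall>j\<in>{N..N + g N}. dist (xs i) (xs j) \<le> 1 / (real k + 1)"
    for k g
  proof -
    obtain N p where N: "N \<le> Psi b \<theta> M \<alpha> k g"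
      and p: "p \<in> common_approx_fixpoints f \<gamma> (chi g N (4 * k + 3))"
        "dist (xs N) p \<le> 1 / (real (4 * k + 3) + 1)"
      using close[where X = "\<lambda>n. chi g n (4 * k + 3)" and B = "\<lambda>n. Psi0 b \<theta> M n k g" and q = "4 * k + 3"]
      by (auto simp: mono_chi Psi_def)
    have "dist (xs i) (xs j) \<le> 1 / (real k + 1)" if "i \<in> {N..N + g N}" "j \<in> {N..N + g N}" for i j
    proof -
      have "dist (xs i) (xs j) \<le> dist (xs i) p + dist (xs j) p"
        by (rule dist_triangle2)
      \<comment> \<open>With \<open>q = r = 4 * k + 3\<close>, each of the two distances to
        \<open>p\<close> is at most \<open>2 / (4 * k + 4)\<close>.\<close>
      also have "\<dots> \<le> 4 * (1 / (real (4 * k + 3) + 1))"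
        using near[where g = g, OF p(1) order_refl p(2) that(1)] near[where g = g, OF p(1) order_refl p(2) that(2)] by simp
      also have "\<dots> = 1 / (real k + 1)"
        by (simp add: divide_simps)
      finally show ?thesis .
    qed
    with N show ?thesis
      by blast
  qed
  moreover have "\<exists>N\<le>Omega b \<theta> M \<alpha> k g.
      (\<forall>i\<in>{N..N + g N}. \<forall>j\<in>{N..N + g N}. dist (xs i) (xs j) \<le> 1 / (real k + 1)) \<and>
      (\<forall>i\<in>{N..N + g N}. \<forall>m\<le>k. dist (xs i) (resolvent (\<gamma> m) f (xs i)) \<le> 1 / (real k + 1))"
    for k g
  proof -
    \<comment> \<open>A quarter of the target: the displacement of an iterate will be split into
      \<open>\<epsilon> + 2 * \<epsilon> + \<epsilon>\<close>.\<close>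
    define \<epsilon> where "\<epsilon> = 1 / (4 * (real k + 1))"
    have "mono (\<lambda>n. chi_tilde k g n (8 * k + 8))"
      unfolding chi_tilde_eq by (intro monoI max.mono monoD[OF mono_chi] order_refl)
    then obtain N p where N: "N \<le> Omega b \<theta> M \<alpha> k g"
      and p: "p \<in> common_approx_fixpoints f \<gamma> (chi_tilde k g N (8 * k + 8))"
        "dist (xs N) p \<le> 1 / (real (8 * k + 7) + 1)"
      using close[where X = "\<lambda>n. chi_tilde k g n (8 * k + 8)" and B = "\<lambda>n. Omega0 b \<theta> M n k g" and q = "8 * k + 7"]
      by (auto simp: Omega_def)
    have dp: "dist (xs i) p \<le> \<epsilon>" if "i \<in> {N..N + g N}" for i
    proof -
      \<comment> \<open>Each error is at most \<open>1 / (8 * k + 8)\<close>, half of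
        \<open>\<epsilon>\<close>.\<close>
      have "dist (xs i) p \<le> 1 / (real (8 * k + 7) + 1) + 1 / (real (8 * k + 8) + 1)"
        by (rule near[where g = g, OF p(1) _ p(2) that]) (simp add: chi_tilde_eq)
      also have "1 / (real (8 * k + 8) + 1) \<le> 1 / (real (8 * k + 7) + 1)"
        by (simp add: frac_le)
      also have "1 / (real (8 * k + 7) + 1) + 1 / (real (8 * k + 7) + 1) = \<epsilon>"
        by (simp add: \<epsilon>_def divide_simps)
      finally show ?thesis
        by simp
    qed
    \<comment> \<open>This is the purpose of \<open>2 * k + 1\<close> in \<open>chi_tilde\<close>:
      it covers the resolvents with index up to \<open>k\<close> and gives displacement at most
      \<open>1 / (2 * k + 2)\<close>, which is \<open>2 * \<epsilon>\<close>.\<close>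
    have "p \<in> common_approx_fixpoints f \<gamma> (2 * k + 1)"
      using p(1) antimonoD[OF antimono_common_approx_fixpoints, of "2 * k + 1" "chi_tilde k g N (8 * k + 8)"]
      by (auto simp: chi_tilde_eq)
    then have Jp: "dist p (resolvent (\<gamma> m) f p) \<le> 2 * \<epsilon>" if "m \<le> k" for m
    proof -
      have "dist p (resolvent (\<gamma> m) f p) \<le> 1 / (real (2 * k + 1) + 1)"
        using \<open>p \<in> common_approx_fixpoints f \<gamma> (2 * k + 1)\<close> that
        by (simp add: common_approx_fixpoints_def)
      also have "\<dots> = 2 * \<epsilon>"
        by (simp add: \<epsilon>_def divide_simps)
      finally show ?thesis .
    qed
    have quarters: "1 / (real k + 1) = 4 * \<epsilon>"
      by (simp add: \<epsilon>_def divide_simps)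
    have "dist (xs i) (xs j) \<le> 1 / (real k + 1)" if "i \<in> {N..N + g N}" "j \<in> {N..N + g N}" for i j
    proof -
      have "0 \<le> \<epsilon>"
        by (simp add: \<epsilon>_def)
      then show ?thesis
        using dist_triangle2[of "xs i" "xs j" p] dp[OF that(1)] dp[OF that(2)] unfolding quarters by linarith
    qed
    moreover have "dist (xs i) (resolvent (\<gamma> m) f (xs i)) \<le> 1 / (real k + 1)"
      if "i \<in> {N..N + g N}" "m \<le> k" for i m
    proof -
      let ?J = "resolvent (\<gamma> m) f"
      \<comment> \<open>Go from the iterate to \<open>p\<close>, then to \<open>?J p\<close>, then
        back; nonexpansivity makes the last leg no longer than the first.\<close>
      have "dist (xs i) (?J (xs i)) \<le> dist (xs i) p + dist p (?J p) + dist (?J p) (?J (xs i))"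
        by metric
      moreover have "dist (?J p) (?J (xs i)) \<le> dist (xs i) p"
        using resolvent_nonexpansive[OF gamma_pos, of m p "xs i"] by (simp add: dist_commute)
      ultimately show ?thesis
        using dp[OF that(1)] Jp[OF that(2)] unfolding quarters by linarith
    qed
    ultimately show ?thesis
      using N by blast
  qed
  ultimately show ?thesis
    unfolding rate_of_metastability_def by blast
qed

end
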